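(* Let $\theta=(\theta_1,\theta_2)\in(0,\pi/2)\times(0,\pi/2)$ be such that the matrix $S_\theta$ is invertible, let $\mathbf{u}_\theta$ be the SVO-Nash equilibrium, and let $(\psi,t)=\Theta_\psi^{-1}(\theta_1,\theta_2)$, i.e. $(\psi,t)\in(0,\pi/2)\times(0,\infty)$ with $\tan\theta_1=t\cos\psi$ and $\cot\theta_2=t\sin\psi$. Let $H_\psi=\mathrm{blkdiag}(\cos\psi\, I_{d_1},\ \sin\psi\, I_{d_2})$ and suppose $M_1H_\psi^{-1}M_2^{-1}$ is diagonalizable (over $\mathbb{C}$) with eigenvalues $\lambda_{\psi 1},\dots,\lambda_{\psi d}$, a basis of right eigenvectors $V_{\psi 1},\dots,V_{\psi d}$, and corresponding left eigenvectors $W_{\psi 1}^\top,\dots,W_{\psi d}^\top$ normalized so that $W_{\psi i}^\top V_{\psi j}=\delta_{ij}$. Then $$\mathbf{u}_\theta=\mathbf{u}_1+G_\psi(t)\,\big[\mathbf{u}_2-\mathbf{u}_1\big],$$ where $$G_\psi(t)=\Big[\tfrac1t\,M_1H_\psi^{-1}M_2^{-1}+I\Big]^{-\top}=\sum_{i=1}^d W_{\psi i}\,\frac{t}{\lambda_{\psi i}+t}\,V_{\psi i}^\top .$$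
   Context: Two-player quadratic game: $d_1,d_2\ge 1$, $d=d_1+d_2$, joint action $u=(u_1,u_2)\in\mathbb{R}^{d_1}\times\mathbb{R}^{d_2}$. Costs $J_i(u)=\tfrac12u^\top M_iu+c_i^\top u$, $i=1,2$, with symmetric real matrices $$M_1=\begin{bmatrix} A_1 & B_1^\top \\ B_1 & D_1 \end{bmatrix},\quad M_2=\begin{bmatrix} D_2 & B_2 \\ B_2^\top & A_2 \end{bmatrix},\quad c_1=\begin{bmatrix} a_1 \\ b_1 \end{bmatrix},\quad c_2=\begin{bmatrix} b_2 \\ a_2 \end{bmatrix},$$ where $A_1,D_2\in\mathbb{R}^{d_1\times d_1}$, $A_2,D_1\in\mathbb{R}^{d_2\times d_2}$, $B_1\in\mathbb{R}^{d_2\times d_1}$, $B_2\in\mathbb{R}^{d_1\times d_2}$, $a_1,b_2\in\mathbb{R}^{d_1}$, $a_2,b_1\in\mathbb{R}^{d_2}$. Standing assumptions: $A_1,A_2\succ0$, and $M_1$, $M_2$, $\mathbf{M}=\begin{bmatrix} A_1 & B_2 \\ B_1 & A_2 \end{bmatrix}$, $\mathbf{N}=\begin{bmatrix} D_2 & B_1^\top \\ B_2^\top & D_1 \end{bmatrix}$ are invertible. The individual optima are $\mathbf{u}_1^\top=-c_1^\top M_1^{-1}$ and $\mathbf{u}_2^\top=-c_2^\top M_2^{-1}$ (vectors in $\mathbb{R}^d$). For social value orientations $\theta=(\theta_1,\theta_2)$ player $i$ uses the cost $\cos\theta_i\,J_i+\sin\theta_i\,J_{-i}$. The SVO-Nash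 equilibrium is the solution of the two first-order conditions (each in the player's own action), i.e. $\mathbf{u}_\theta^\top=-s_\theta^\top S_\theta^{-1}$, where $$s_\theta=\begin{bmatrix}\cos\theta_1a_1+\sin\theta_1b_2 \\ \cos\theta_2a_2+\sin\theta_2b_1\end{bmatrix},\quad S_\theta=\begin{bmatrix}\cos\theta_1A_1+\sin\theta_1D_2 & \cos\theta_2B_2+\sin\theta_2B_1^\top \\ \cos\theta_1B_1+\sin\theta_1B_2^\top & \cos\theta_2A_2+\sin\theta_2D_1\end{bmatrix}.$$ $X^{-\top}$ denotes $(X^{-1})^\top$. *)

theory Defs
  imports "HOL-Analysis.Analysis"
begin

text \<open>
  The action spaces of the two players are \<open>real ^ 'n\<close> and \<open>real ^ 'm\<close>; joint actions live in
  \<open>real ^ ('n + 'm)\<close>, the coordinates \<open>Inl i\<close> belonging to player 1 and the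
  coordinates \<open>Inr i\<close> to player 2.
\<close>

definition block_vec :: "'a ^ 'n \<Rightarrow> 'a ^ 'm \<Rightarrow> 'a ^ ('n::finite + 'm::finite)" where
  "block_vec x y = (\<chi> k. case k of Inl i \<Rightarrow> x $ i | Inr i \<Rightarrow> y $ i)"

definition upper_vec :: "'a ^ ('n::finite + 'm::finite) \<Rightarrow> 'a ^ 'n" where
  "upper_vec u = (\<chi> i. u $ Inl i)"

definition lower_vec :: "'a ^ ('n::finite + 'm::finite) \<Rightarrow> 'a ^ 'm" where
  "lower_vec u = (\<chi> i. u $ Inr i)"

definition block_mat ::
  "'a ^ 'n ^ 'n \<Rightarrow> 'a ^ 'm ^ 'n \<Rightarrow> 'a ^ 'n ^ 'm \<Rightarrow> 'a ^ 'm ^ 'm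
    \<Rightarrow> 'a ^ ('n::finite + 'm::finite) ^ ('n + 'm)" where
  "block_mat P Q R S =
    (\<chi> k l. case k of
        Inl i \<Rightarrow> (case l of Inl j \<Rightarrow> P $ i $ j | Inr j \<Rightarrow> Q $ i $ j)
      | Inr i \<Rightarrow> (case l of Inl j \<Rightarrow> R $ i $ j | Inr j \<Rightarrow> S $ i $ j))"

definition sym_pos_def :: "real ^ 'n ^ 'n \<Rightarrow> bool" where
  "sym_pos_def A \<longleftrightarrow> transpose A = A \<and> (\<forall>x. x \<noteq> 0 \<longrightarrow> 0 < x \<bullet> (A *v x))"

definition quad_cost :: "real ^ 'k ^ 'k \<Rightarrow> real ^ 'k \<Rightarrow> real ^ 'k \<Rightarrow> real" where
  "quad_cost M c u = 1/2 * (u \<bullet> (M *v u)) + c \<bullet> u"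

definition individual_optimum :: "real ^ 'k ^ 'k \<Rightarrow> real ^ 'k \<Rightarrow> real ^ 'k" where
  "individual_optimum M c = - (c v* matrix_inv M)"

definition svo_cost :: "real \<Rightarrow> ('b \<Rightarrow> real) \<Rightarrow> ('b \<Rightarrow> real) \<Rightarrow> 'b \<Rightarrow> real" where
  "svo_cost \<phi> J J' u = cos \<phi> * J u + sin \<phi> * J' u"

text \<open>
  The equilibrium is defined by the two first-order conditions: the derivative of each player's
  SVO cost with respect to that player's own action vanishes.
\<close>

definition svo_nash ::
  "(real ^ ('n::finite + 'm::finite) \<Rightarrow> real) \<Rightarrow> (real ^ ('n + 'm) \<Rightarrow> real) \<Rightarrow> real \<Rightarrow> real
    \<Rightarrow> real ^ ('n + 'm) \<Rightarrow> bool" where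
  "svo_nash J1 J2 \<theta>1 \<theta>2 u \<longleftrightarrow>
    ((\<lambda>x. svo_cost \<theta>1 J1 J2 (block_vec x (lower_vec u))) has_derivative (\<lambda>h. 0))
      (at (upper_vec u)) \<and>
    ((\<lambda>y. svo_cost \<theta>2 J2 J1 (block_vec (upper_vec u) y)) has_derivative (\<lambda>h. 0))
      (at (lower_vec u))"

definition svo_s ::
  "real ^ 'n \<Rightarrow> real ^ 'm \<Rightarrow> real ^ 'm \<Rightarrow> real ^ 'n \<Rightarrow> real \<Rightarrow> real
    \<Rightarrow> real ^ ('n::finite + 'm::finite)" where
  "svo_s a1 b1 a2 b2 \<theta>1 \<theta>2 =
    block_vec (cos \<theta>1 *\<^sub>R a1 + sin \<theta>1 *\<^sub>R b2) (cos \<theta>2 *\<^sub>R a2 + sin \<theta>2 *\<^sub>R b1)"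

definition svo_S ::
  "real ^ 'n ^ 'n \<Rightarrow> real ^ 'n ^ 'm \<Rightarrow> real ^ 'm ^ 'm \<Rightarrow> real ^ 'm ^ 'm \<Rightarrow> real ^ 'm ^ 'n \<Rightarrow> real ^ 'n ^ 'n
    \<Rightarrow> real \<Rightarrow> real \<Rightarrow> real ^ ('n::finite + 'm::finite) ^ ('n + 'm)" where
  "svo_S A1 B1 D1 A2 B2 D2 \<theta>1 \<theta>2 =
    block_mat
      (cos \<theta>1 *\<^sub>R A1 + sin \<theta>1 *\<^sub>R D2)
      (cos \<theta>2 *\<^sub>R B2 + sin \<theta>2 *\<^sub>R transpose B1)
      (cos \<theta>1 *\<^sub>R B1 + sin \<theta>1 *\<^sub>R transpose B2)
      (cos \<theta>2 *\<^sub>R A2 + sin \<theta>2 *\<^sub>R D1)"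

definition svo_H :: "real \<Rightarrow> real ^ ('n::finite + 'm::finite) ^ ('n + 'm)" where
  "svo_H \<psi> = block_mat (mat (cos \<psi>)) 0 0 (mat (sin \<psi>))"

definition svo_K ::
  "real ^ ('n::finite + 'm::finite) ^ ('n + 'm) \<Rightarrow> real ^ ('n + 'm) ^ ('n + 'm) \<Rightarrow> real
    \<Rightarrow> real ^ ('n + 'm) ^ ('n + 'm)" where
  "svo_K M1 M2 \<psi> = M1 ** matrix_inv (svo_H \<psi>) ** matrix_inv M2"

definition svo_G ::
  "real ^ ('n::finite + 'm::finite) ^ ('n + 'm) \<Rightarrow> real ^ ('n + 'm) ^ ('n + 'm) \<Rightarrow> real \<Rightarrow> real
    \<Rightarrow> real ^ ('n + 'm) ^ ('n + 'm)" where
  "svo_G M1 M2 \<psi> t = transpose (matrix_inv ((1/t) *\<^sub>R svo_K M1 M2 \<psi> + mat 1))"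


text \<open>
  The first-order conditions are the linear system with matrix \<open>transpose S\<close>, so for invertible
  \<open>S\<close> the equilibrium exists, is unique, and is given by the closed formula.
\<close>

lemma sum_UNIV_sum_type:
  fixes f :: "('n::finite + 'm::finite) \<Rightarrow> 'b::comm_monoid_add"
  shows "sum f UNIV = (\<Sum>i\<in>UNIV. f (Inl i)) + (\<Sum>i\<in>UNIV. f (Inr i))"
  by (simp add: UNIV_Plus_UNIV[symmetric] sum.Plus del: UNIV_Plus_UNIV)

lemma block_vec_upper_lower: "block_vec (upper_vec u) (lower_vec u) = u"
  by (simp add: block_vec_def upper_vec_def lower_vec_def vec_eq_iff split: sum.split)

lemma bounded_linear_block_vec_upper: "bounded_linear (\<lambda>h::real^'n::finite. block_vec h (0::real^'m::finite))"
  by (rule linear_conv_bounded_linear[THEN iffD1], rule linearI)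
     (auto simp: block_vec_def vec_eq_iff split: sum.split)

lemma bounded_linear_block_vec_lower: "bounded_linear (\<lambda>h::real^'m::finite. block_vec (0::real^'n::finite) h)"
  by (rule linear_conv_bounded_linear[THEN iffD1], rule linearI)
     (auto simp: block_vec_def vec_eq_iff split: sum.split)

lemma block_vec_split:
  fixes x :: "real ^ 'n::finite" and y :: "real ^ 'm::finite"
  shows "block_vec x y = block_vec x 0 + block_vec 0 y"
  by (simp add: block_vec_def vec_eq_iff split: sum.split)

lemma has_derivative_block_vec_upper:
  "((\<lambda>x::real^'n::finite. block_vec x (y::real^'m::finite)) has_derivative (\<lambda>h. block_vec h 0)) (at x)"
  using has_derivative_add[OF
      bounded_linear.has_derivative[OF bounded_linear_block_vec_upper has_derivative_ident]
      has_derivative_const[of "block_vec 0 y"]]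
  by (simp add: block_vec_split[symmetric])

lemma has_derivative_block_vec_lower:
  "((\<lambda>y::real^'m::finite. block_vec (x::real^'n::finite) y) has_derivative (\<lambda>h. block_vec 0 h)) (at y)"
  using has_derivative_add[OF has_derivative_const[of "block_vec x 0"]
      bounded_linear.has_derivative[OF bounded_linear_block_vec_lower has_derivative_ident]]
  by (simp add: block_vec_split[symmetric])

lemma inner_block_vec:
  fixes g :: "real ^ ('n::finite + 'm::finite)"
  shows "block_vec h k \<bullet> g = h \<bullet> upper_vec g + k \<bullet> lower_vec g"
  by (simp add: inner_vec_def sum_UNIV_sum_type block_vec_def upper_vec_def lower_vec_def)

lemma has_derivative_quad_cost:
  assumes "transpose M = M"
  shows "(quad_cost M c has_derivative (\<lambda>h. h \<bullet> (M *v u + c))) (at u)"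
proof -
  have "bounded_linear ((*v) M)"
    by simp
  note [derivative_intros] = bounded_linear.has_derivative[OF this]
  have sym: "x \<bullet> (M *v y) = y \<bullet> (M *v x)" for x y
    using dot_lmul_matrix[of x M y] transpose_matrix_vector[of M x] assms
    by (simp add: inner_commute)
  have "(quad_cost M c has_derivative
      (\<lambda>h. 1/2 * (u \<bullet> (M *v h) + h \<bullet> (M *v u)) + c \<bullet> h)) (at u)"
    unfolding quad_cost_def[abs_def] by (intro derivative_intros)
  moreover have "1/2 * (u \<bullet> (M *v h) + h \<bullet> (M *v u)) + c \<bullet> h = h \<bullet> (M *v u + c)" for h
    using sym[of u h] by (simp add: inner_add_right inner_commute[of c])
  ultimately show ?thesis
    by simp
qed

lemma svo_nash_quad_iff:
  fixes u c1 c2 :: "real ^ ('n::finite + 'm::finite)"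
  assumes "transpose M1 = M1" "transpose M2 = M2"
  defines "g1 \<equiv> M1 *v u + c1" and "g2 \<equiv> M2 *v u + c2"
  shows "svo_nash (quad_cost M1 c1) (quad_cost M2 c2) \<theta>1 \<theta>2 u \<longleftrightarrow>
    upper_vec (cos \<theta>1 *\<^sub>R g1 + sin \<theta>1 *\<^sub>R g2) = 0 \<and>
    lower_vec (cos \<theta>2 *\<^sub>R g2 + sin \<theta>2 *\<^sub>R g1) = 0"
proof -
  let ?e1 = "cos \<theta>1 *\<^sub>R g1 + sin \<theta>1 *\<^sub>R g2" and ?e2 = "cos \<theta>2 *\<^sub>R g2 + sin \<theta>2 *\<^sub>R g1"
  have d1: "(svo_cost \<theta>1 (quad_cost M1 c1) (quad_cost M2 c2) has_derivative (\<lambda>h. h \<bullet> ?e1)) (at u)"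
    unfolding svo_cost_def[abs_def] g1_def g2_def
    unfolding inner_add_right inner_scaleR_right
    by (intro has_derivative_add has_derivative_mult_right
        has_derivative_quad_cost[unfolded inner_add_right] assms)
  have d2: "(svo_cost \<theta>2 (quad_cost M2 c2) (quad_cost M1 c1) has_derivative (\<lambda>h. h \<bullet> ?e2)) (at u)"
    unfolding svo_cost_def[abs_def] g1_def g2_def
    unfolding inner_add_right inner_scaleR_right
    by (intro has_derivative_add has_derivative_mult_right
        has_derivative_quad_cost[unfolded inner_add_right] assms)
  have D1: "((\<lambda>x. svo_cost \<theta>1 (quad_cost M1 c1) (quad_cost M2 c2) (block_vec x (lower_vec u)))
      has_derivative (\<lambda>h. h \<bullet> upper_vec ?e1)) (at (upper_vec u))"
    using has_derivative_compose[OF has_derivative_block_vec_upper[of "lower_vec u" "upper_vec u"],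
        unfolded block_vec_upper_lower, OF d1]
    by (simp add: inner_block_vec)
  have D2: "((\<lambda>y. svo_cost \<theta>2 (quad_cost M2 c2) (quad_cost M1 c1) (block_vec (upper_vec u) y))
      has_derivative (\<lambda>h. h \<bullet> lower_vec ?e2)) (at (lower_vec u))"
    using has_derivative_compose[OF has_derivative_block_vec_lower[of "upper_vec u" "lower_vec u"],
        unfolded block_vec_upper_lower, OF d2]
    by (simp add: inner_block_vec)
  have z: "(\<lambda>h. h \<bullet> v) = (\<lambda>h. 0) \<longleftrightarrow> v = 0" for v :: "real ^ 'k::finite"
    using inner_eq_zero_iff[of v] by (auto dest: fun_cong[of _ _ v])
  show ?thesis
    unfolding svo_nash_def
  proof (intro conj_cong iffI)
    show "upper_vec ?e1 = 0" if "((\<lambda>x. svo_cost \<theta>1 (quad_cost M1 c1) (quad_cost M2 c2)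
        (block_vec x (lower_vec u))) has_derivative (\<lambda>h. 0)) (at (upper_vec u))"
      using has_derivative_unique[OF D1 that] by (rule z[THEN iffD1])
    show "lower_vec ?e2 = 0" if "((\<lambda>y. svo_cost \<theta>2 (quad_cost M2 c2) (quad_cost M1 c1)
        (block_vec (upper_vec u) y)) has_derivative (\<lambda>h. 0)) (at (lower_vec u))"
      using has_derivative_unique[OF D2 that] by (rule z[THEN iffD1])
  qed (use D1 D2 in simp_all)
qed

lemma transpose_block_mat:
  "transpose (block_mat P Q R S) = block_mat (transpose P) (transpose R) (transpose Q) (transpose S)"
  by (simp add: block_mat_def transpose_def vec_eq_iff split: sum.split)

lemma block_mat_vec:
  fixes P :: "real ^ 'n::finite ^ 'n" and S :: "real ^ 'm::finite ^ 'm"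
  shows "block_mat P Q R S *v u =
    block_vec (P *v upper_vec u + Q *v lower_vec u) (R *v upper_vec u + S *v lower_vec u)"
  by (simp add: block_mat_def block_vec_def upper_vec_def lower_vec_def vec_eq_iff
      matrix_vector_mult_def sum_UNIV_sum_type split: sum.split)

lemma block_mat_eq_iff:
  "block_mat P Q R S = block_mat P' Q' R' S' \<longleftrightarrow> P = P' \<and> Q = Q' \<and> R = R' \<and> S = S'"
  by (auto simp: block_mat_def vec_eq_iff split: sum.splits)

lemma block_vec_eq_0_iff: "block_vec x y = 0 \<longleftrightarrow> x = 0 \<and> y = 0"
  by (auto simp: block_vec_def vec_eq_iff split: sum.splits)

lemma block_vec_add: "block_vec x y + block_vec x' y' = block_vec (x + x') (y + y')"
  by (simp add: block_vec_def vec_eq_iff split: sum.split)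

lemma upper_lower_block_vec [simp]:
  "upper_vec (block_vec x y) = x" "lower_vec (block_vec x y) = y"
  by (simp_all add: block_vec_def upper_vec_def lower_vec_def)

lemma upper_lower_lin:
  fixes u v :: "real ^ ('n::finite + 'm::finite)"
  shows "upper_vec (u + v) = upper_vec u + upper_vec v" "upper_vec (r *\<^sub>R u) = r *\<^sub>R upper_vec u"
    "lower_vec (u + v) = lower_vec u + lower_vec v" "lower_vec (r *\<^sub>R u) = r *\<^sub>R lower_vec u"
  by (simp_all add: upper_vec_def lower_vec_def vec_eq_iff)

lemma matrix_inv_both:
  assumes "invertible A"
  shows "A ** matrix_inv A = mat 1" "matrix_inv A ** A = mat 1"
  using someI_ex[OF assms[unfolded invertible_def]] by (simp_all add: matrix_inv_def)

lemma transpose_add: "transpose (A + B) = transpose A + transpose (B :: real ^ 'k ^ 'l)"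
  by (simp add: transpose_def vec_eq_iff)

lemma transpose_scaleR: "transpose (r *\<^sub>R A) = r *\<^sub>R transpose (A :: real ^ 'k ^ 'l)"
  by (simp add: transpose_def vec_eq_iff)

theorem svo_nash_iff_formula:
  fixes A1 D2 :: "real ^ 'n::finite ^ 'n" and A2 D1 :: "real ^ 'm::finite ^ 'm"
    and B1 :: "real ^ 'n ^ 'm" and B2 :: "real ^ 'm ^ 'n"
  assumes M1: "M1 = block_mat A1 (transpose B1) B1 D1" "transpose M1 = M1"
    and M2: "M2 = block_mat D2 B2 (transpose B2) A2" "transpose M2 = M2"
    and c: "c1 = block_vec a1 b1" "c2 = block_vec b2 a2"
    and S: "invertible (svo_S A1 B1 D1 A2 B2 D2 \<theta>1 \<theta>2)"
  shows "svo_nash (quad_cost M1 c1) (quad_cost M2 c2) \<theta>1 \<theta>2 u \<longleftrightarrow>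
    u = - (svo_s a1 b1 a2 b2 \<theta>1 \<theta>2 v* matrix_inv (svo_S A1 B1 D1 A2 B2 D2 \<theta>1 \<theta>2))"
proof -
  let ?S = "svo_S A1 B1 D1 A2 B2 D2 \<theta>1 \<theta>2" and ?s = "svo_s a1 b1 a2 b2 \<theta>1 \<theta>2"
  have sym: "transpose A1 = A1" "transpose D1 = D1" "transpose A2 = A2" "transpose D2 = D2"
    using M1(2) M2(2) unfolding M1(1) M2(1) transpose_block_mat block_mat_eq_iff by auto
  have "transpose ?S *v u + ?s = block_vec
      (upper_vec (cos \<theta>1 *\<^sub>R (M1 *v u + c1) + sin \<theta>1 *\<^sub>R (M2 *v u + c2)))
      (lower_vec (cos \<theta>2 *\<^sub>R (M2 *v u + c2) + sin \<theta>2 *\<^sub>R (M1 *v u + c1)))"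
    unfolding svo_S_def svo_s_def transpose_block_mat block_mat_vec M1(1) M2(1) c
      transpose_add transpose_scaleR transpose_transpose sym block_vec_add upper_lower_lin
      upper_lower_block_vec
    by (intro arg_cong2[where f = block_vec])
       (simp_all add: matrix_vector_mult_add_rdistrib scaleR_matrix_vector_assoc[symmetric]
         scaleR_add_right del: transpose_matrix_vector)
  then have "svo_nash (quad_cost M1 c1) (quad_cost M2 c2) \<theta>1 \<theta>2 u \<longleftrightarrow> transpose ?S *v u + ?s = 0"
    unfolding svo_nash_quad_iff[OF M1(2) M2(2)] by (simp add: block_vec_eq_0_iff)
  also have "\<dots> \<longleftrightarrow> u v* ?S = - ?s"
    by (simp add: eq_neg_iff_add_eq_0)
  also have "\<dots> \<longleftrightarrow> u = (- ?s) v* matrix_inv ?S"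
  proof
    assume "u v* ?S = - ?s"
    then have "(u v* ?S) v* matrix_inv ?S = (- ?s) v* matrix_inv ?S"
      by simp
    then show "u = (- ?s) v* matrix_inv ?S"
      by (simp only: vector_matrix_mul_assoc matrix_inv_both[OF S] vector_matrix_mul_rid)
  next
    assume "u = (- ?s) v* matrix_inv ?S"
    then show "u v* ?S = - ?s"
      by (simp only: vector_matrix_mul_assoc matrix_inv_both[OF S] vector_matrix_mul_rid)
  qed
  also have "(- ?s) v* matrix_inv ?S = - (?s v* matrix_inv ?S)"
    by (simp add: vector_matrix_mult_def vec_eq_iff sum_negf)
  finally show ?thesis .
qed

end

theory Submission
  imports Defs
begin

text \<open>
  Dividing the first-order condition of player 1 by \<open>cos \<theta>1\<close> and that of player 2 by \<open>sin \<theta>2\<close>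
  turns the two partial gradient conditions into one equation between full gradients,
  \<open>\<nabla>J1 u + t H \<nabla>J2 u = 0\<close>, because the weights that remain in front of \<open>J2\<close> are
  \<open>tan \<theta>1 = t cos \<psi>\<close> and \<open>cot \<theta>2 = t sin \<psi>\<close> (\<open>svo_nash_stacked_gradient\<close>). The cost gradients
  are \<open>M1 (u - u1)\<close> and \<open>M2 (u - u2)\<close>, so the equilibrium satisfies
  \<open>(M1 + t H M2) (u - u1) = t H M2 (u2 - u1)\<close>.

  With \<open>K = M1 H\<^sup>-\<^sup>1 M2\<^sup>-\<^sup>1\<close>, the factorization \<open>t (K / t + I) M2 H = M1 + t M2 H\<close> and the symmetry
  of \<open>M1\<close>, \<open>M2\<close>, \<open>H\<close> rewrite this as \<open>(K / t + I)\<^sup>T (u - u1) = u2 - u1\<close>, which is the closed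
  formula. Invertibility of \<open>K / t + I\<close> is inherited from the equilibrium matrix: the column
  blocks of \<open>S\<close> carry the same factors \<open>cos \<theta>1\<close> and \<open>sin \<theta>2\<close>, so \<open>S\<close> is \<open>M1 + t M2 H\<close> times an
  invertible block scaling (\<open>svo_S_factorization\<close>).

  For the spectral formula, every right eigenvector \<open>V i\<close> of \<open>K\<close> is a right eigenvector of
  \<open>(K / t + I)\<^sup>-\<^sup>1\<close> with eigenvalue \<open>t / (ev i + t)\<close>, hence a left eigenvector of its transpose
  \<open>G\<close>. A matrix is determined by its action on a spanning family, and the biorthogonal family
  \<open>W\<close> writes that action as a sum of rank-one matrices (\<open>spectral_expansion_left\<close>).
\<close>

section \<open>Block scalings\<close>

definition block_scaling :: "real \<Rightarrow> real \<Rightarrow> real ^ ('n::finite + 'm::finite) ^ ('n + 'm)" where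
  "block_scaling p q = block_mat (mat p) 0 0 (mat q)"

lemma block_mat_add:
  fixes P :: "real ^ 'n::finite ^ 'n" and S :: "real ^ 'm::finite ^ 'm"
  shows "block_mat P Q R S + block_mat P' Q' R' S' = block_mat (P + P') (Q + Q') (R + R') (S + S')"
  by (simp add: block_mat_def vec_eq_iff split: sum.split)

lemma block_mat_scaleR:
  fixes P :: "real ^ 'n::finite ^ 'n" and S :: "real ^ 'm::finite ^ 'm"
  shows "r *\<^sub>R block_mat P Q R S = block_mat (r *\<^sub>R P) (r *\<^sub>R Q) (r *\<^sub>R R) (r *\<^sub>R S)"
  by (simp add: block_mat_def vec_eq_iff split: sum.split)

lemma block_mat_mult_block_scaling:
  fixes P :: "real ^ 'n::finite ^ 'n" and S :: "real ^ 'm::finite ^ 'm"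
  shows "block_mat P Q R S ** block_scaling p q =
    block_mat (p *\<^sub>R P) (q *\<^sub>R Q) (p *\<^sub>R R) (q *\<^sub>R S)"
  by (simp add: block_scaling_def block_mat_def vec_eq_iff matrix_matrix_mult_def sum_UNIV_sum_type
      mat_def if_distrib[of "(*) _"] mult.commute split: sum.split cong: if_cong)

lemma transpose_block_scaling: "transpose (block_scaling p q) = block_scaling p q"
  by (simp add: block_scaling_def block_mat_def transpose_def mat_def vec_eq_iff split: sum.split)

lemma block_scaling_vec:
  fixes u :: "real ^ ('n::finite + 'm::finite)"
  shows "block_scaling p q *v u = block_vec (p *\<^sub>R upper_vec u) (q *\<^sub>R lower_vec u)"
proof -
  have *: "mat r *v x = r *\<^sub>R x" for r and x :: "real ^ 'k::finite"
    by (simp add: matrix_vector_mult_def mat_def vec_eq_iff if_distrib[of "\<lambda>x. x * _"] cong: if_cong)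
  then show ?thesis
    by (simp add: block_scaling_def block_mat_vec *)
qed

lemma invertible_block_scaling:
  assumes "p \<noteq> 0" "q \<noteq> 0"
  shows "invertible (block_scaling p q :: real ^ ('n::finite + 'm::finite) ^ ('n + 'm))"
proof -
  have "(mat 1 :: real ^ ('n + 'm) ^ ('n + 'm)) = block_scaling p q ** block_scaling (1/p) (1/q)"
    unfolding block_scaling_def[of p q] block_mat_mult_block_scaling
    using assms by (simp add: block_mat_def mat_def vec_eq_iff split: sum.split)
  then show ?thesis
    by (metis invertible_right_inverse)
qed

lemma svo_H_eq_block_scaling: "svo_H \<psi> = block_scaling (cos \<psi>) (sin \<psi>)"
  by (simp add: svo_H_def block_scaling_def)

section \<open>The equilibrium system\<close>

text \<open>
  The individual optimum is the stationary point of the cost, so centring there removes the linear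
  term of the gradient.
\<close>

lemma quad_gradient_eq:
  fixes M :: "real ^ 'k::finite ^ 'k"
  assumes "transpose M = M" "invertible M"
  shows "M *v u + c = M *v (u - individual_optimum M c)"
proof -
  have "M *v (c v* matrix_inv M) = (c v* matrix_inv M) v* M"
    using transpose_matrix_vector[of M] assms(1) by simp
  also have "\<dots> = c"
    by (simp only: vector_matrix_mul_assoc matrix_inv_both[OF assms(2)] vector_matrix_mul_rid)
  finally show ?thesis
    by (simp add: individual_optimum_def matrix_vector_right_distrib)
qed

text \<open>
  Each first-order condition is homogeneous in its pair of weights \<open>(cos \<theta>i, sin \<theta>i)\<close>. Normalizing
  the weight of the gradient of \<open>J1\<close> to 1 in both blocks, by dividing by \<open>cos \<theta>1\<close> and \<open>sin \<theta>2\<close>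
  respectively, leaves \<open>tan \<theta>1\<close> and \<open>cot \<theta>2\<close> as weights of the gradient of \<open>J2\<close>; these two
  numbers are the diagonal entries of \<open>t *\<^sub>R svo_H \<psi>\<close>.
\<close>

lemma svo_nash_stacked_gradient:
  fixes M1 M2 :: "real ^ ('n::finite + 'm::finite) ^ ('n + 'm)"
  assumes sym: "transpose M1 = M1" "transpose M2 = M2"
    and nz: "cos \<theta>1 \<noteq> 0" "sin \<theta>2 \<noteq> 0"
    and par: "tan \<theta>1 = t * cos \<psi>" "cot \<theta>2 = t * sin \<psi>"
    and nash: "svo_nash (quad_cost M1 c1) (quad_cost M2 c2) \<theta>1 \<theta>2 u"
  shows "(M1 *v u + c1) + t *\<^sub>R (svo_H \<psi> *v (M2 *v u + c2)) = 0"
proof -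
  define g1 where "g1 = M1 *v u + c1"
  define g2 where "g2 = M2 *v u + c2"
  have w: "sin \<theta>1 = cos \<theta>1 * (t * cos \<psi>)" "cos \<theta>2 = sin \<theta>2 * (t * sin \<psi>)"
    using nz unfolding par[symmetric] by (simp_all add: tan_def cot_def)
  have "cos \<theta>1 *\<^sub>R upper_vec g1 + sin \<theta>1 *\<^sub>R upper_vec g2 = 0"
    "cos \<theta>2 *\<^sub>R lower_vec g2 + sin \<theta>2 *\<^sub>R lower_vec g1 = 0"
    using nash unfolding svo_nash_quad_iff[OF sym] g1_def[symmetric] g2_def[symmetric]
      upper_lower_lin by auto
  then have "cos \<theta>1 *\<^sub>R (upper_vec g1 + (t * cos \<psi>) *\<^sub>R upper_vec g2) = 0"
    "sin \<theta>2 *\<^sub>R (lower_vec g1 + (t * sin \<psi>) *\<^sub>R lower_vec g2) = 0"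
    unfolding w by (simp_all add: scaleR_add_right add.commute)
  then have "upper_vec (g1 + t *\<^sub>R (svo_H \<psi> *v g2)) = 0" "lower_vec (g1 + t *\<^sub>R (svo_H \<psi> *v g2)) = 0"
    using nz by (simp_all add: upper_lower_lin svo_H_eq_block_scaling block_scaling_vec)
  then show ?thesis
    unfolding g1_def[symmetric] g2_def[symmetric]
    by (metis block_vec_upper_lower block_vec_eq_0_iff)
qed

text \<open>
  The columns of \<open>svo_S\<close> belong to the players, so the same normalization acts on it by a column
  scaling. This is how invertibility passes from \<open>svo_S\<close> to \<open>M1 + t M2 H\<close>.
\<close>

lemma svo_S_factorization:
  fixes A1 D2 :: "real ^ 'n::finite ^ 'n" and A2 D1 :: "real ^ 'm::finite ^ 'm"
  assumes nz: "cos \<theta>1 \<noteq> 0" "sin \<theta>2 \<noteq> 0"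
    and par: "tan \<theta>1 = t * cos \<psi>" "cot \<theta>2 = t * sin \<psi>"
  shows "svo_S A1 B1 D1 A2 B2 D2 \<theta>1 \<theta>2 =
    (block_mat A1 (transpose B1) B1 D1
      + t *\<^sub>R (block_mat D2 B2 (transpose B2) A2 ** svo_H \<psi>)) ** block_scaling (cos \<theta>1) (sin \<theta>2)"
proof -
  have w: "sin \<theta>1 = cos \<theta>1 * (t * cos \<psi>)" "cos \<theta>2 = sin \<theta>2 * (t * sin \<psi>)"
    using nz unfolding par[symmetric] by (simp_all add: tan_def cot_def)
  show ?thesis
    unfolding svo_S_def svo_H_eq_block_scaling block_mat_mult_block_scaling block_mat_scaleR
      block_mat_add block_mat_eq_iff
    by (simp add: scaleR_add_right w add.commute)
qed

section \<open>Spectral expansion\<close>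

text \<open>
  Acting on row vectors, the rank-one sum sends each \<open>V j\<close> to \<open>\<mu> j *s V j\<close> because biorthogonality
  kills every other term. It therefore agrees with \<open>B\<close> on a spanning family.
\<close>

lemma spectral_expansion_left:
  fixes B :: "'a::field ^ 'k::finite ^ 'k" and V W :: "'i \<Rightarrow> 'a ^ 'k"
  assumes fin: "finite I"
    and span: "vec.span (V ` I) = UNIV"
    and eigen: "\<And>i. i \<in> I \<Longrightarrow> V i v* B = \<mu> i *s V i"
    and WV: "\<And>i j. i \<in> I \<Longrightarrow> j \<in> I \<Longrightarrow> (\<Sum>k\<in>UNIV. W i $ k * V j $ k) = (if i = j then 1 else 0)"
  shows "B = (\<Sum>i\<in>I. columnvector (\<mu> i *s W i) ** (rowvector (V i) :: 'a ^ 'k ^ 1))"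
    (is "B = ?Q")
proof -
  have entry: "?Q $ a $ b = (\<Sum>i\<in>I. \<mu> i * W i $ a * V i $ b)" for a b
    by (simp add: matrix_matrix_mult_def columnvector_def rowvector_def)
  have Q: "V j v* ?Q = \<mu> j *s V j" if j: "j \<in> I" for j
  proof -
    have "(V j v* ?Q) $ b = (\<mu> j *s V j) $ b" for b
    proof -
      have "(V j v* ?Q) $ b = (\<Sum>a\<in>UNIV. \<Sum>i\<in>I. (\<mu> i * V i $ b) * (W i $ a * V j $ a))"
        unfolding vector_matrix_mult_def entry by (simp add: sum_distrib_left sum_distrib_right mult_ac)
      also have "\<dots> = (\<Sum>i\<in>I. (\<mu> i * V i $ b) * (\<Sum>a\<in>UNIV. W i $ a * V j $ a))"
        by (subst sum.swap) (simp add: sum_distrib_left)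
      also have "\<dots> = (\<Sum>i\<in>I. if i = j then \<mu> i * V i $ b else 0)"
        by (intro sum.cong) (auto simp: WV j)
      also have "\<dots> = (\<mu> j *s V j) $ b"
        using fin j by simp
      finally show ?thesis .
    qed
    then show ?thesis
      by (simp add: vec_eq_iff)
  qed
  have "transpose B *v x = transpose ?Q *v x" for x
  proof (rule vec.linear_eq_on[where f = "(*v) (transpose B)" and g = "(*v) (transpose ?Q)"
        and x = x and B = "V ` I"])
    show "x \<in> vec.span (V ` I)"
      by (simp add: span)
    show "transpose B *v v = transpose ?Q *v v" if "v \<in> V ` I" for v
      using that eigen Q by auto
  qed (rule matrix_vector_mul_linear_gen)+
  then have "transpose B = transpose ?Q"
    by (subst matrix_eq) blast
  then show ?thesis
    by (metis transpose_transpose)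
qed

lemma matrix_mult_add_rdistrib:
  fixes A B :: "'a::semiring_1 ^ 'k::finite ^ 'l::finite"
  shows "(A + B) ** C = A ** C + B ** C"
  by (simp add: matrix_matrix_mult_def vec_eq_iff distrib_right sum.distrib)

lemma map_matrix_of_real_mult:
  "map_matrix complex_of_real (A ** B) = map_matrix complex_of_real A ** map_matrix complex_of_real B"
  by (simp add: map_matrix_def matrix_matrix_mult_def vec_eq_iff)

lemma map_matrix_of_real_one: "map_matrix complex_of_real (mat 1) = mat 1"
  by (simp add: map_matrix_def mat_def vec_eq_iff)

lemma transpose_map_matrix: "transpose (map_matrix f A) = map_matrix f (transpose A)"
  by (simp add: map_matrix_def transpose_def vec_eq_iff)

lemma map_matrix_of_real_shift_vec:
  "map_matrix complex_of_real (r *\<^sub>R A + mat 1) *v x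
    = of_real r *s (map_matrix complex_of_real A *v x) + x"
  by (simp add: matrix_vector_mult_def mat_def vec_eq_iff distrib_right sum.distrib
      sum_distrib_left mult.assoc if_distrib[of of_real] if_distrib[of "\<lambda>x. x * _"] cong: if_cong)

text \<open>
  Applying \<open>R\<close> to the eigenvalue relation gives \<open>x = \<nu> *s (R *v x)\<close>. As \<open>x\<close> is nonzero, so is
  \<open>\<nu>\<close>, and dividing by it exhibits \<open>x\<close> as an eigenvector of \<open>R\<close>.
\<close>

lemma eigenvector_of_inverse:
  fixes L R :: "'a::field ^ 'k::finite ^ 'k"
  assumes inv: "R ** L = mat 1" and x: "x \<noteq> 0" and eigen: "L *v x = \<nu> *s x"
  shows "\<nu> \<noteq> 0" "R *v x = inverse \<nu> *s x"
proof -
  have "x = R *v (L *v x)"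
    by (simp add: matrix_vector_mul_assoc inv)
  also have "\<dots> = \<nu> *s (R *v x)"
    by (simp add: eigen vec.scale)
  finally have *: "x = \<nu> *s (R *v x)" .
  with x show "\<nu> \<noteq> 0"
    by auto
  then show "R *v x = inverse \<nu> *s x"
    by (subst *) (simp add: vector_smult_assoc)
qed

section \<open>The equilibrium formula\<close>

theorem proposition3:
  fixes A1 D2 :: "real ^ 'n::finite ^ 'n"
    and A2 D1 :: "real ^ 'm::finite ^ 'm"
    and B1 :: "real ^ 'n ^ 'm"
    and B2 :: "real ^ 'm ^ 'n"
    and a1 b2 :: "real ^ 'n"
    and a2 b1 :: "real ^ 'm"
    and M1 M2 :: "real ^ ('n + 'm) ^ ('n + 'm)"
    and c1 c2 u1 u2 usvo :: "real ^ ('n + 'm)"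
    and \<theta>1 \<theta>2 \<psi> t :: real
    and ev :: "nat \<Rightarrow> complex"
    and V W :: "nat \<Rightarrow> complex ^ ('n + 'm)"
  assumes M1_def: "M1 = block_mat A1 (transpose B1) B1 D1"
    and M2_def: "M2 = block_mat D2 B2 (transpose B2) A2"
    and c1_def: "c1 = block_vec a1 b1"
    and c2_def: "c2 = block_vec b2 a2"
    and M1_sym: "transpose M1 = M1"
    and M2_sym: "transpose M2 = M2"
    and A1_pos: "sym_pos_def A1"
    and A2_pos: "sym_pos_def A2"
    and M1_inv: "invertible M1"
    and M2_inv: "invertible M2"
    and M_inv: "invertible (block_mat A1 B2 B1 A2)"
    and N_inv: "invertible (block_mat D2 (transpose B1) (transpose B2) D1)"
    and u1_def: "u1 = individual_optimum M1 c1"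
    and u2_def: "u2 = individual_optimum M2 c2"
    and \<theta>1: "0 < \<theta>1" "\<theta>1 < pi / 2"
    and \<theta>2: "0 < \<theta>2" "\<theta>2 < pi / 2"
    and S_inv: "invertible (svo_S A1 B1 D1 A2 B2 D2 \<theta>1 \<theta>2)"
    and usvo: "svo_nash (quad_cost M1 c1) (quad_cost M2 c2) \<theta>1 \<theta>2 usvo"
    and \<psi>: "0 < \<psi>" "\<psi> < pi / 2"
    and t: "0 < t"
    and tan_\<theta>1: "tan \<theta>1 = t * cos \<psi>"
    and cot_\<theta>2: "cot \<theta>2 = t * sin \<psi>"
    and V_inj: "inj_on V {1..CARD('n + 'm)}"
    and V_indep: "vec.independent (V ` {1..CARD('n + 'm)})"
    and V_span: "vec.span (V ` {1..CARD('n + 'm)}) = UNIV"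
    and V_eigen: "\<And>i. i \<in> {1..CARD('n + 'm)} \<Longrightarrow>
      map_matrix complex_of_real (svo_K M1 M2 \<psi>) *v V i = ev i *s V i"
    and W_eigen: "\<And>i. i \<in> {1..CARD('n + 'm)} \<Longrightarrow>
      W i v* map_matrix complex_of_real (svo_K M1 M2 \<psi>) = ev i *s W i"
    and WV: "\<And>i j. i \<in> {1..CARD('n + 'm)} \<Longrightarrow> j \<in> {1..CARD('n + 'm)} \<Longrightarrow>
      (\<Sum>k\<in>UNIV. W i $ k * V j $ k) = (if i = j then 1 else 0)"
  shows "invertible ((1 / t) *\<^sub>R svo_K M1 M2 \<psi> + mat 1)
    \<and> usvo = u1 + svo_G M1 M2 \<psi> t *v (u2 - u1)
    \<and> (\<forall>i \<in> {1..CARD('n + 'm)}. ev i + of_real t \<noteq> 0)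
    \<and> map_matrix complex_of_real (svo_G M1 M2 \<psi> t)
        = (\<Sum>i = 1..CARD('n + 'm).
            columnvector ((of_real t / (ev i + of_real t)) *s W i) ** (rowvector (V i) :: complex ^ ('n + 'm) ^ 1))"
proof -
  define H :: "real ^ ('n + 'm) ^ ('n + 'm)" where "H = svo_H \<psi>"
  define K where "K = svo_K M1 M2 \<psi>"
  define L where "L = (1 / t) *\<^sub>R K + mat 1"
  have nz: "cos \<theta>1 \<noteq> 0" "sin \<theta>2 \<noteq> 0"
    using \<theta>1 \<theta>2 cos_gt_zero_pi[of \<theta>1] sin_gt_zero[of \<theta>2] by auto
  have "cos \<psi> \<noteq> 0" "sin \<psi> \<noteq> 0"
    using \<psi> cos_gt_zero_pi[of \<psi>] sin_gt_zero[of \<psi>] by auto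
  then have H_inv: "invertible H"
    unfolding H_def svo_H_eq_block_scaling by (rule invertible_block_scaling)
  have H_sym: "transpose H = H"
    unfolding H_def svo_H_eq_block_scaling by (rule transpose_block_scaling)

  have "K ** (M2 ** H) = M1 ** (matrix_inv H ** ((matrix_inv M2 ** M2) ** H))"
    by (simp add: K_def svo_K_def H_def matrix_mul_assoc)
  then have K_fact: "K ** (M2 ** H) = M1"
    by (simp add: matrix_inv_both[OF M2_inv] matrix_inv_both[OF H_inv])
  have L_fact: "L ** (M2 ** H) = (1 / t) *\<^sub>R M1 + M2 ** H"
    unfolding L_def by (simp add: matrix_mult_add_rdistrib scalar_matrix_assoc[symmetric] K_fact)

  have "invertible ((M1 + t *\<^sub>R (M2 ** H)) ** block_scaling (cos \<theta>1) (sin \<theta>2))"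
    using S_inv unfolding svo_S_factorization[OF nz tan_\<theta>1 cot_\<theta>2] M1_def M2_def H_def .
  then have "det (M1 + t *\<^sub>R (M2 ** H)) \<noteq> 0"
    by (simp add: invertible_det_nz det_mul)
  moreover have "M1 + t *\<^sub>R (M2 ** H) = L ** (t *\<^sub>R (M2 ** H))"
    using t by (simp add: matrix_scalar_ac scalar_matrix_assoc[symmetric] L_fact scaleR_add_right)
  ultimately have "det L \<noteq> 0"
    by (auto simp: det_mul)
  then have L_inv: "invertible L"
    by (simp add: invertible_det_nz)
  note LR = matrix_inv_both[OF L_inv]

  have formula: "usvo = u1 + svo_G M1 M2 \<psi> t *v (u2 - u1)"
  proof -
    define w where "w = usvo - u1"
    define v where "v = u2 - u1"
    have "M1 *v w + t *\<^sub>R (H *v (M2 *v (w - v))) = 0"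
      using svo_nash_stacked_gradient[OF M1_sym M2_sym nz tan_\<theta>1 cot_\<theta>2 usvo]
      unfolding quad_gradient_eq[OF M1_sym M1_inv] quad_gradient_eq[OF M2_sym M2_inv]
        u1_def[symmetric] u2_def[symmetric] H_def w_def v_def by simp
    then have "(1 / t) *\<^sub>R (M1 *v w + t *\<^sub>R (H *v (M2 *v (w - v)))) = 0"
      by simp
    then have gradient: "(1 / t) *\<^sub>R (M1 *v w) + (H ** M2) *v (w - v) = 0"
      using t by (simp add: scaleR_add_right matrix_vector_mul_assoc)
    \<comment> \<open>Transposing the factorization of \<open>L\<close> moves \<open>H M2\<close> to the left, where the gradient equation
      has it, and injectivity of \<open>H M2\<close> then cancels it.\<close>
    have "(H ** M2) ** transpose L = transpose (L ** (M2 ** H))"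
      by (simp add: matrix_transpose_mul H_sym M2_sym)
    also have "\<dots> = (1 / t) *\<^sub>R M1 + H ** M2"
      by (simp add: L_fact transpose_add transpose_scaleR matrix_transpose_mul H_sym M1_sym M2_sym)
    finally have "(H ** M2) *v (transpose L *v w) = ((1 / t) *\<^sub>R M1 + H ** M2) *v w"
      unfolding matrix_vector_mul_assoc by simp
    also have "\<dots> = (1 / t) *\<^sub>R (M1 *v w) + (H ** M2) *v w"
      by (simp add: matrix_vector_mult_add_rdistrib scaleR_matrix_vector_assoc)
    also have "\<dots> = (H ** M2) *v v"
      using gradient by (simp add: matrix_vector_mult_diff_distrib algebra_simps)
    finally have "(H ** M2) *v (transpose L *v w) = (H ** M2) *v v" .
    moreover have "inj ((*v) (H ** M2))"
      using invertible_mult[OF H_inv M2_inv] by (rule inj_matrix_vector_mult)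
    ultimately have "transpose L *v w = v"
      by (rule injD[rotated])
    then have "transpose (matrix_inv L) *v v = transpose (L ** matrix_inv L) *v w"
      unfolding matrix_transpose_mul matrix_vector_mul_assoc[symmetric] by simp
    also have "\<dots> = w"
      by (simp add: LR transpose_mat)
    finally show ?thesis
      unfolding svo_G_def K_def[symmetric] L_def[symmetric] v_def w_def
      by (simp add: algebra_simps)
  qed

  define Lc where "Lc = map_matrix complex_of_real L"
  define Rc where "Rc = map_matrix complex_of_real (matrix_inv L)"
  have "Rc ** Lc = mat 1"
    by (simp add: Lc_def Rc_def LR map_matrix_of_real_one flip: map_matrix_of_real_mult)
  moreover have "V i \<noteq> 0" if "i \<in> {1..CARD('n + 'm)}" for i
    using WV[OF that that] by auto
  moreover have "Lc *v V i = ((ev i + of_real t) / of_real t) *s V i"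
    if "i \<in> {1..CARD('n + 'm)}" for i
    using t V_eigen[OF that] unfolding Lc_def L_def map_matrix_of_real_shift_vec K_def
    by (simp add: vec_eq_iff field_simps)
  ultimately have
    ev_nz: "(ev i + of_real t) / of_real t \<noteq> 0" and
    R_eigen: "Rc *v V i = inverse ((ev i + of_real t) / of_real t) *s V i"
    if "i \<in> {1..CARD('n + 'm)}" for i
    using that eigenvector_of_inverse by blast+
  have Gc: "map_matrix complex_of_real (svo_G M1 M2 \<psi> t) = transpose Rc"
    by (simp add: svo_G_def Rc_def L_def K_def transpose_map_matrix)
  have G_eigen: "V i v* map_matrix complex_of_real (svo_G M1 M2 \<psi> t)
      = (of_real t / (ev i + of_real t)) *s V i" if "i \<in> {1..CARD('n + 'm)}" for i
    unfolding Gc using R_eigen[OF that] by simp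
  have "map_matrix complex_of_real (svo_G M1 M2 \<psi> t)
      = (\<Sum>i = 1..CARD('n + 'm).
          columnvector ((of_real t / (ev i + of_real t)) *s W i) ** (rowvector (V i) :: complex ^ ('n + 'm) ^ 1))"
    by (rule spectral_expansion_left[OF _ V_span G_eigen WV]) simp_all
  moreover have "\<forall>i \<in> {1..CARD('n + 'm)}. ev i + of_real t \<noteq> 0"
    using ev_nz by auto
  ultimately show ?thesis
    using L_inv formula unfolding L_def K_def by blast
qed

end
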